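(* Let $0<p<1$ and $0<\lambda\le 1$. For every $f\in\mathcal{V}_p(\lambda)$ there exists $w\in\mathcal{B}$ such that $$f(z)=\frac{-pz}{(z-p)\bigl(1-\lambda p z\, w(z)\bigr)},\qquad z\in\mathbb{D}.$$ Also, for every $f\in\mathcal{V}_p(\lambda)$ there exists $u\in\mathcal{B}$ with $u(0)=1-\lambda p$ such that $$f(z)=\frac{-pz\,u(z)}{(z-p)(1-\lambda p)},\qquad z\in\mathbb{D}.$$
   Context: $\mathbb{D}=\{z\in\mathbb{C}:|z|<1\}$. $\mathcal{B}$ denotes the class of functions $w$ analytic in $\mathbb{D}$ with $|w(z)|\le 1$ for all $z\in\mathbb{D}$. For $p\in(0,1)$, $\mathcal{A}(p)$ is the class of functions $f$ on $\mathbb{D}$ that are analytic in $\mathbb{D}\setminus\{p\}$, have a simple pole at $z=p$, and satisfy $f(0)=0=f'(0)-1$. For $f\in\mathcal{A}(p)$ set $U_f(z)=\left(\frac{z}{f(z)}\right)^2 f'(z)-1$ (with removable singularities, at $z=0$ and $z=p$, removed). For $0<\lambda\le 1$, $\mathcal{V}_p(\lambda)=\{f\in\mathcal{A}(p): |U_f(z)|<\lambda \text{ for all } z\in\mathbb{D}\}$. *)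

theory Defs
  imports "HOL-Complex_Analysis.Complex_Analysis"
begin

definition class_B :: "(complex \<Rightarrow> complex) set" where
  "class_B = {w. w analytic_on ball 0 1 \<and> (\<forall>z\<in>ball 0 1. norm (w z) \<le> 1)}"

text \<open>The value of a function of class \<open>A(p)\<close> at the pole \<open>p\<close> itself is irrelevant.\<close>

definition class_A :: "real \<Rightarrow> (complex \<Rightarrow> complex) set" where
  "class_A p = {f. f analytic_on (ball 0 1 - {of_real p}) \<and>
                   is_pole f (of_real p) \<and> zorder f (of_real p) = -1 \<and>
                   f 0 = 0 \<and> deriv f 0 = 1}"

text \<open>
  Only the singularities at \<open>0\<close> and \<open>p\<close> are removed. Using the function \<open>remove_sings\<close>
  everywhere would be wrong: it assigns the value 0 to a pole of \<open>U_f\<close>, such as a further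
  zero of \<open>f\<close>.
\<close>

definition U_op :: "real \<Rightarrow> (complex \<Rightarrow> complex) \<Rightarrow> complex \<Rightarrow> complex" where
  "U_op p f z =
     (let U = (\<lambda>\<zeta>. (\<zeta> / f \<zeta>)\<^sup>2 * deriv f \<zeta> - 1)
      in if z = 0 \<or> z = of_real p then remove_sings U z else U z)"

definition class_V :: "real \<Rightarrow> real \<Rightarrow> (complex \<Rightarrow> complex) set" where
  "class_V p lam = {f \<in> class_A p. \<forall>z\<in>ball 0 1. norm (U_op p f z) < lam}"

text \<open>
  A function with a further zero is not in the class, since \<open>U_f\<close> is not finite there. The
  convention \<open>x / 0 = 0\<close> agrees with this: it gives \<open>U_f\<close> the value \<open>-1\<close> at such a point.
\<close>

lemma class_V_nonzero:
  assumes "lam \<le> 1" "f \<in> class_V p lam" "z \<in> ball 0 1" "z \<noteq> 0" "z \<noteq> of_real p"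
  shows "f z \<noteq> 0"
proof
  assume "f z = 0"
  with assms have "norm (U_op p f z) = 1"
    by (simp add: U_op_def)
  moreover have "norm (U_op p f z) < lam"
    using assms(2,3) by (simp add: class_V_def)
  ultimately show False
    using assms(1) by simp
qed

end

theory Submission
  imports Defs
begin

text \<open>
  The function \<open>g = z / f\<close> extends holomorphically to the disc with \<open>g 0 = 1\<close> and \<open>g p = 0\<close>, and
  \<open>U_f = g - z g' - 1\<close>. Hence \<open>k = (g - 1) / z\<close> satisfies \<open>z\<^sup>2 k' = - U_f\<close>, so \<open>|k'| \<le> \<lambda>\<close> by the
  maximum principle. As \<open>k p = - 1 / p\<close>, the required function is
  \<open>w = (k z - k p) / (\<lambda> (z - p))\<close>, which is bounded by 1 because \<open>k\<close> is \<open>\<lambda>\<close>-Lipschitz. Finally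
  \<open>u = (1 - \<lambda> p) / (1 - \<lambda> p z w)\<close>.
\<close>

text \<open>On the circle of radius \<open>r\<close> the factor \<open>z ^ n\<close> has modulus
  exactly \<open>r ^ n\<close>, so the maximum principle gives
  \<open>norm (F z) \<le> M / r ^ n\<close>, and the loss disappears as \<open>r\<close> tends to 1.
  A bound near the unit circle suffices, so exceptional points inside the disc do no harm.\<close>

lemma norm_le_from_power_mult_bound:
  fixes F :: "complex \<Rightarrow> complex"
  assumes hol: "F holomorphic_on ball 0 1" and "s < 1"
    and bound: "\<And>z. s < norm z \<Longrightarrow> norm z < 1 \<Longrightarrow> norm (z ^ n * F z) \<le> M"
    and z: "z \<in> ball 0 1"
  shows "norm (F z) \<le> M"
proof -
  have "norm (F z) * r ^ n \<le> M" if r: "max 0 (max s (norm z)) < r" "r < 1" for r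
  proof -
    have "norm (F z) \<le> M / r ^ n"
    proof (rule maximum_modulus_frontier[of F "cball 0 r"])
      have "F holomorphic_on cball 0 r"
        using hol r by (elim holomorphic_on_subset) auto
      then show "F holomorphic_on interior (cball 0 r)" "continuous_on (closure (cball 0 r)) F"
        by (auto elim: holomorphic_on_subset intro: holomorphic_on_imp_continuous_on)
      show "norm (F \<zeta>) \<le> M / r ^ n" if "\<zeta> \<in> frontier (cball 0 r)" for \<zeta>
        using bound[of \<zeta>] that r
        by (simp add: norm_mult norm_power pos_le_divide_eq mult.commute)
    qed (use r in auto)
    then show ?thesis
      using r by (simp add: pos_le_divide_eq)
  qed
  moreover have "max 0 (max s (norm z)) < 1"
    using \<open>s < 1\<close> z by auto
  ultimately have "eventually (\<lambda>r. norm (F z) * r ^ n \<le> M) (at_left 1)"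
    unfolding eventually_at_left_field by blast
  moreover have "((\<lambda>r. norm (F z) * r ^ n) \<longlongrightarrow> norm (F z) * 1 ^ n) (at_left 1)"
    by (intro tendsto_intros)
  ultimately show ?thesis
    using tendsto_upperbound[of "\<lambda>r. norm (F z) * r ^ n" _ "at_left 1" M] by simp
qed

text \<open>Convexity turns the derivative bound into a Lipschitz bound. The quotient carries its
  limit at \<open>a\<close> as value there, the form in which \<open>pole_lemma_open\<close> gives
  holomorphy.\<close>

lemma norm_difference_quotient_le:
  fixes F :: "complex \<Rightarrow> complex"
  assumes hol: "F holomorphic_on S" and S: "open S" "convex S"
    and bound: "\<And>z. z \<in> S \<Longrightarrow> norm (deriv F z) \<le> M"
    and "a \<in> S" "z \<in> S"
  shows "norm (if z = a then deriv F a else (F z - F a) / (z - a)) \<le> M"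
proof -
  have "norm (F z - F a) \<le> M * norm (z - a)"
    using assms
    by (intro field_differentiable_bound[of S F "deriv F"])
      (auto intro: holomorphic_derivI)
  then show ?thesis
    using bound[OF \<open>a \<in> S\<close>] by (auto simp: norm_divide pos_divide_le_eq)
qed

text \<open>Passing to \<open>z / f\<close> makes the condition linear:
  \<open>g' = (f - z f') / f\<^sup>2\<close> yields \<open>(z / f)\<^sup>2 f' = g - z g'\<close>.
  The bound is stated off 0 and \<open>p\<close> only, so the values of \<open>remove_sings\<close>
  there are never computed.\<close>

lemma class_V_reciprocal:
  fixes p lam :: real
  assumes p: "0 < p" "p < 1" and lam: "lam \<le> 1" and f: "f \<in> class_V p lam"
  obtains g where "g holomorphic_on ball 0 1" "g 0 = 1" "g (of_real p) = 0"
    "\<And>z. z \<in> ball 0 1 \<Longrightarrow> z \<noteq> of_real p \<Longrightarrow> f z = z / g z"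
    "\<And>z. z \<in> ball 0 1 \<Longrightarrow> z \<noteq> 0 \<Longrightarrow> z \<noteq> of_real p \<Longrightarrow>
       norm (g z - z * deriv g z - 1) < lam"
proof
  \<comment> \<open>The two special values are the limits of \<open>z / f z\<close>. At 0 the plain
    quotient would be \<open>0 / 0 = 0\<close>, and at \<open>p\<close> it would depend on the
    arbitrary value \<open>f p\<close>.\<close>
  define g where "g z = (if z = 0 then 1 else if z = of_real p then 0 else z / f z)" for z
  define D where "D = ball (0::complex) 1 - {0, of_real p}"
  have openD: "open D"
    unfolding D_def by (intro open_Diff) auto
  have f_ana: "f analytic_on (ball 0 1 - {of_real p})" and pole: "is_pole f (of_real p)"
    and f0: "f 0 = 0" and f'0: "deriv f 0 = 1"
    using f by (auto simp: class_V_def class_A_def)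
  have nz: "f z \<noteq> 0" if "z \<in> D" for z
    using class_V_nonzero[OF lam f] that by (auto simp: D_def)
  have holf: "f holomorphic_on D"
    using f_ana by (auto simp: D_def intro: analytic_imp_holomorphic analytic_on_subset)
  have holg: "g holomorphic_on D"
  proof (rule holomorphic_transform)
    show "(\<lambda>z. z / f z) holomorphic_on D"
      using nz by (intro holomorphic_intros holf)
  qed (auto simp: D_def g_def)
  \<comment> \<open>Continuity at 0 and \<open>p\<close> is enough, since isolated singularities of
    a continuous function are removable.\<close>
  have "isCont g z" if "z \<in> ball 0 1" for z
  proof -
    consider "z \<in> D" | "z = 0" | "z = of_real p"
      using \<open>z \<in> ball 0 1\<close> by (auto simp: D_def)
    then show ?thesis
    proof cases
      case 1
      then show ?thesis
        using holg openD holomorphic_on_imp_continuous_on continuous_on_eq_continuous_at by blast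
    next
      case 2
      have "f field_differentiable at 0"
        using f_ana p by (auto intro!: analytic_on_imp_differentiable_at)
      then have "(f has_field_derivative 1) (at 0)"
        using f'0 DERIV_deriv_iff_field_differentiable by metis
      then have "((\<lambda>z. f z / z) \<longlongrightarrow> 1) (at 0)"
        by (simp add: has_field_derivative_iff f0)
      then have "((\<lambda>z. inverse (f z / z)) \<longlongrightarrow> inverse 1) (at 0)"
        by (rule tendsto_inverse) simp
      \<comment> \<open>The radius \<open>p\<close> keeps the punctured disc about 0 away from
        \<open>p\<close>; about \<open>p\<close> the same radius keeps away from 0.\<close>
      moreover have "eventually (\<lambda>z. inverse (f z / z) = g z) (at 0)"
        using p by (auto simp: eventually_at g_def intro!: exI[of _ p])
      ultimately have "(g \<longlongrightarrow> 1) (at 0)"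
        by (simp add: tendsto_cong)
      then show ?thesis
        using 2 by (simp add: isCont_def g_def)
    next
      case 3
      have "((\<lambda>z. inverse (f z)) \<longlongrightarrow> 0) (at (of_real p))"
        using pole by (auto simp: is_pole_def intro: filterlim_compose[OF tendsto_inverse_0])
      then have "((\<lambda>z. z * inverse (f z)) \<longlongrightarrow> of_real p * 0) (at (of_real p))"
        by (intro tendsto_intros)
      moreover have "eventually (\<lambda>z. z * inverse (f z) = g z) (at (of_real p))"
        using p by (auto simp: eventually_at g_def divide_inverse dist_norm intro!: exI[of _ p])
      ultimately have "(g \<longlongrightarrow> 0) (at (of_real p))"
        by (simp add: tendsto_cong)
      then show ?thesis
        using 3 p by (simp add: isCont_def g_def)
    qed
  qed
  then show "g holomorphic_on ball 0 1"
    using no_isolated_singularity[of "ball 0 1" g "{0, of_real p}"] holg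
    by (auto simp: D_def continuous_at_imp_continuous_on)
  show "g 0 = 1" "g (of_real p) = 0"
    using p by (auto simp: g_def)
  show "f z = z / g z" if "z \<in> ball 0 1" "z \<noteq> of_real p" for z
    using that nz[of z] f0 by (auto simp: g_def D_def)
  show "norm (g z - z * deriv g z - 1) < lam"
    if "z \<in> ball 0 1" "z \<noteq> 0" "z \<noteq> of_real p" for z
  proof -
    have z: "z \<in> D"
      using that by (simp add: D_def)
    have "(f has_field_derivative deriv f z) (at z)"
      using holf openD z by (rule holomorphic_derivI)
    then have "((\<lambda>z. z / f z) has_field_derivative (f z - z * deriv f z) / (f z * f z)) (at z)"
      using nz[OF z] by (auto intro!: derivative_eq_intros)
    then have "(g has_field_derivative (f z - z * deriv f z) / (f z * f z)) (at z)"
      by (rule DERIV_cong_ev[THEN iffD1, rotated -1, OF _ refl _ refl])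
        (use openD z in \<open>auto simp: eventually_nhds D_def g_def intro!: exI[of _ D]\<close>)
    then have "g z - z * deriv g z - 1 = U_op p f z"
      using that nz[OF z]
      by (simp add: DERIV_imp_deriv U_op_def g_def field_simps power2_eq_square)
    then show ?thesis
      using f that by (simp add: class_V_def)
  qed
qed

lemma class_V_representation:
  fixes p lam :: real
  assumes p: "0 < p" "p < 1" and lam: "0 < lam" "lam \<le> 1" and f: "f \<in> class_V p lam"
  obtains w where "w \<in> class_B"
    "\<And>z. z \<in> ball 0 1 - {of_real p} \<Longrightarrow>
       f z = - (of_real p * z) / ((z - of_real p) * (1 - of_real lam * of_real p * z * w z))"
proof -
  obtain g where holg: "g holomorphic_on ball 0 1" and g0: "g 0 = 1" and gp: "g (of_real p) = 0"
    and fg: "\<And>z. z \<in> ball 0 1 \<Longrightarrow> z \<noteq> of_real p \<Longrightarrow> f z = z / g z"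
    and U: "\<And>z. z \<in> ball 0 1 \<Longrightarrow> z \<noteq> 0 \<Longrightarrow> z \<noteq> of_real p \<Longrightarrow>
       norm (g z - z * deriv g z - 1) < lam"
    using class_V_reciprocal[OF p lam(2) f] by metis
  define k where "k z = (if z = 0 then deriv g 0 else (g z - g 0) / (z - 0))" for z
  define w where "w z = (if z = of_real p then deriv k (of_real p)
    else (k z - k (of_real p)) / (z - of_real p)) / of_real lam" for z
  have pD: "of_real p \<in> ball (0::complex) 1"
    using p by simp
  have gk: "g z = 1 + z * k z" for z
    by (simp add: k_def g0)
  \<comment> \<open>This is where the pole of \<open>f\<close> enters: it forces \<open>g\<close> to
    vanish at \<open>p\<close> and so fixes the value of \<open>k\<close> there.\<close>
  have kp: "of_real p * k (of_real p) = -1"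
    using gk[of "of_real p"] gp by (simp add: eq_neg_iff_add_eq_0 add.commute)
  have holk: "k holomorphic_on ball 0 1"
    unfolding k_def by (rule pole_lemma_open[OF holg open_ball])
  \<comment> \<open>The annulus \<open>p < norm z < 1\<close> contains neither 0 nor
    \<open>p\<close>, so \<open>U\<close> applies. Differentiating \<open>g = 1 + z k\<close> gives
    \<open>z\<^sup>2 k' = - (g - z g' - 1)\<close>.\<close>
  have "norm (z ^ 2 * deriv k z) \<le> lam" if "p < norm z" "norm z < 1" for z
  proof -
    have "(k has_field_derivative deriv k z) (at z)"
      using holk that by (intro holomorphic_derivI[of k "ball 0 1"]) auto
    then have "((\<lambda>z. 1 + z * k z) has_field_derivative (k z + z * deriv k z)) (at z)"
      by (auto intro!: derivative_eq_intros)
    then have "deriv g z = k z + z * deriv k z"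
      using gk by (metis DERIV_imp_deriv ext)
    then have "z ^ 2 * deriv k z = - (g z - z * deriv g z - 1)"
      by (simp add: gk power2_eq_square algebra_simps)
    then have "norm (z ^ 2 * deriv k z) = norm (g z - z * deriv g z - 1)"
      by (simp only: norm_minus_cancel)
    also have "\<dots> < lam"
      using that p by (intro U) auto
    finally show ?thesis
      by simp
  qed
  then have "norm (deriv k z) \<le> lam" if "z \<in> ball 0 1" for z
    using norm_le_from_power_mult_bound[of "deriv k" p 2 lam z] that holk p
    by (auto intro: holomorphic_deriv)
  then have "norm (w z) \<le> 1" if "z \<in> ball 0 1" for z
    using norm_difference_quotient_le[OF holk open_ball convex_ball _ pD that] lam
    by (simp add: w_def norm_divide)
  moreover have "w holomorphic_on ball 0 1"
    unfolding w_def using lam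
    by (intro holomorphic_on_divide pole_lemma_open holk) auto
  ultimately have "w \<in> class_B"
    by (simp add: class_B_def analytic_on_open)
  moreover have "f z = - (of_real p * z) /
      ((z - of_real p) * (1 - of_real lam * of_real p * z * w z))"
    if z: "z \<in> ball 0 1 - {of_real p}" for z
  proof -
    have w: "of_real lam * w z * (z - of_real p) = k z - k (of_real p)"
      using z lam by (simp add: w_def)
    \<comment> \<open>The denominator collapses to \<open>- p g z\<close>: since
      \<open>p k(p) = -1\<close>, the lone \<open>z\<close> cancels and
      \<open>- p (1 + z k z)\<close> remains.\<close>
    have "(z - of_real p) * (1 - of_real lam * of_real p * z * w z) =
        z - of_real p - of_real p * z * (of_real lam * w z * (z - of_real p))"
      by (simp add: algebra_simps)
    also have "\<dots> = z - of_real p - of_real p * z * (k z - k (of_real p))"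
      unfolding w ..
    also have "\<dots> = z - of_real p - z * (of_real p * k z) + z * (of_real p * k (of_real p))"
      by (simp add: algebra_simps)
    also have "\<dots> = - of_real p * g z"
      unfolding kp by (simp add: gk algebra_simps)
    finally show ?thesis
      using fg[of z] z p by simp
  qed
  ultimately show thesis
    by (rule that)
qed

text \<open>As \<open>norm (z * w z) \<le> 1\<close> on the disc, the denominator has modulus at
  least \<open>1 - c > 0\<close>. This gives both analyticity and the bound 1.\<close>

lemma class_B_quotient:
  fixes c :: real
  assumes w: "w \<in> class_B" and c: "0 \<le> c" "c < 1"
  shows "(\<lambda>z. (1 - of_real c) / (1 - of_real c * z * w z)) \<in> class_B"
proof -
  have le: "1 - c \<le> norm (1 - of_real c * z * w z)" if "z \<in> ball 0 1" for z
  proof -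
    have "norm (z * w z) \<le> 1"
      using w that by (auto simp: class_B_def norm_mult intro!: mult_le_one)
    then have "norm (of_real c * z * w z) \<le> c"
      using c by (simp add: norm_mult mult.assoc mult_left_le)
    then show ?thesis
      using norm_triangle_ineq2[of 1 "of_real c * z * w z"] by simp
  qed
  have ne: "1 - of_real c * z * w z \<noteq> 0" if "z \<in> ball 0 1" for z
    using le[OF that] c by auto
  have "norm (1 - of_real c :: complex) = 1 - c"
    using c by (metis abs_of_pos diff_gt_0_iff_gt norm_of_real of_real_1 of_real_diff)
  then have "norm ((1 - of_real c) / (1 - of_real c * z * w z)) \<le> 1" if "z \<in> ball 0 1" for z
    using le[OF that] ne[OF that] by (simp add: norm_divide)
  moreover have "(\<lambda>z. (1 - of_real c) / (1 - of_real c * z * w z)) analytic_on ball 0 1"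
    using w ne by (intro analytic_intros) (auto simp: class_B_def)
  ultimately show ?thesis
    unfolding class_B_def by blast
qed

theorem theorem1:
  fixes p lam :: real
  assumes "0 < p" "p < 1" "0 < lam" "lam \<le> 1"
  shows "(\<forall>f\<in>class_V p lam. \<exists>w\<in>class_B. \<forall>z\<in>ball 0 1 - {of_real p}.
            f z = - (of_real p * z) / ((z - of_real p) * (1 - of_real lam * of_real p * z * w z)))
       \<and> (\<forall>f\<in>class_V p lam. \<exists>u\<in>class_B. u 0 = 1 - of_real lam * of_real p \<and>
            (\<forall>z\<in>ball 0 1 - {of_real p}.
               f z = - (of_real p * z * u z) / ((z - of_real p) * (1 - of_real lam * of_real p))))"
proof (intro conjI ballI)
  fix f assume "f \<in> class_V p lam"
  then obtain w where w: "w \<in> class_B"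
    and fw: "\<And>z. z \<in> ball 0 1 - {of_real p} \<Longrightarrow>
       f z = - (of_real p * z) / ((z - of_real p) * (1 - of_real lam * of_real p * z * w z))"
    using class_V_representation[OF assms] by metis
  then show "\<exists>w\<in>class_B. \<forall>z\<in>ball 0 1 - {of_real p}.
      f z = - (of_real p * z) / ((z - of_real p) * (1 - of_real lam * of_real p * z * w z))"
    by blast
  \<comment> \<open>With this choice \<open>u / (1 - lam p)\<close> equals
    \<open>1 / (1 - lam p z w)\<close>, which turns the first representation into the second. The
    factor \<open>z\<close> in the denominator makes \<open>u 0\<close> independent of
    \<open>w\<close>.\<close>
  define u where "u z = (1 - of_real (lam * p)) / (1 - of_real (lam * p) * z * w z)" for z
  have c: "0 \<le> lam * p" "lam * p < 1"
    using assms mult_le_one[of lam p] mult_strict_mono'[of lam 1 p 1]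
    by (auto simp: mult_le_cancel_right1 intro: le_less_trans[of _ p])
  then have "1 - of_real (lam * p) \<noteq> (0::complex)"
    by (metis eq_iff_diff_eq_0 less_irrefl of_real_1 of_real_eq_iff)
  then have "f z = - (of_real p * z * u z) / ((z - of_real p) * (1 - of_real lam * of_real p))"
    if "z \<in> ball 0 1 - {of_real p}" for z
    unfolding fw[OF that] u_def by (simp add: mult_ac)
  moreover have "u \<in> class_B"
    using class_B_quotient[OF w c] by (simp add: u_def [abs_def])
  moreover have "u 0 = 1 - of_real lam * of_real p"
    by (simp add: u_def)
  ultimately show "\<exists>u\<in>class_B. u 0 = 1 - of_real lam * of_real p \<and>
      (\<forall>z\<in>ball 0 1 - {of_real p}.
         f z = - (of_real p * z * u z) / ((z - of_real p) * (1 - of_real lam * of_real p)))"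
    by blast
qed

end
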